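(* Let $H\le F$ be a non-trivial subgroup with Schreier graph $X=H\backslash F$. The action of $H$ on $(\partial F,\mathfrak m)$ is conservative if and only if $$\lim_{n\to\infty}\frac{|S_X^n|}{|S_F^n|}=\lim_{n\to\infty}\frac{|S_X^n|}{2m(2m-1)^{n-1}}=0 .$$
   Context: $F$ is the free group freely generated by a finite set $\mathcal A$ with $|\mathcal A|=m\ge 2$; $\breve{\mathcal A}=\mathcal A\sqcup\mathcal A^{-1}$. Elements $g\in F$ are identified with finite freely reduced words in $\breve{\mathcal A}$, $|g|$ is the length. $\partial F$ is the set of infinite freely reduced words with the product topology; $F$ acts on it by concatenation followed by free reduction. The uniform measure $\mathfrak m$ is the Borel probability measure on $\partial F$ for which the set of infinite words beginning with $g$ has measure $\frac1{2m(2m-1)^{|g|-1}}$ for every $g\ne e$; it is quasi-invariant under $F$. The Schreier graph $X=H\backslash F$ has the cosets $Hg$ as vertices, and for each vertex $x$ and $a\in\breve{\mathcal A}$ an edge from $x$ to $xa$; $o=H$ is the origin. $S_F^n$ and $S_X^n$ are the spheres of radius $n$ in the Cayley graph of $F$ (with respect to $\breve{\mathcal A}$) centered at $e$ and in $X$ centered at $o$, respectively, for the graph distances. A measure class preserving action of a countable group $G$ on a measure space is conservative if every measurable set $A$ of positive measure is recurrent, i.e. (mod 0) $A\subset\bigcup_{g\ne e}gA$. *)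

theory Defs
  imports "HOL-Probability.Probability_Measure" "HOL-Algebra.Coset"
begin

text \<open>
  The generating set is the finite type \<open>'a\<close>. The letter \<open>(a, True)\<close> is the generator
  \<open>a\<close>, and \<open>(a, False)\<close> is its formal inverse.
\<close>

type_synonym 'a letter = "'a \<times> bool"

definition inv_letter :: "'a letter \<Rightarrow> 'a letter" where
  "inv_letter x = (fst x, \<not> snd x)"

definition reduced :: "'a letter list \<Rightarrow> bool" where
  "reduced w \<longleftrightarrow> successively (\<lambda>x y. y \<noteq> inv_letter x) w"

definition reduce_Cons :: "'a letter \<Rightarrow> 'a letter list \<Rightarrow> 'a letter list" where
  "reduce_Cons x w = (if w \<noteq> [] \<and> hd w = inv_letter x then tl w else x # w)"

definition reduce :: "'a letter list \<Rightarrow> 'a letter list" where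
  "reduce w = foldr reduce_Cons w []"

definition free_group :: "'a letter list monoid" where
  "free_group = \<lparr>carrier = {w. reduced w}, mult = (\<lambda>g h. reduce (g @ h)), one = []\<rparr>"

definition free_boundary :: "(nat \<Rightarrow> 'a letter) set" where
  "free_boundary = {\<omega>. \<forall>n. \<omega> (Suc n) \<noteq> inv_letter (\<omega> n)}"

definition boundary_topology :: "(nat \<Rightarrow> 'a letter) topology" where
  "boundary_topology =
     subtopology (product_topology (\<lambda>_. discrete_topology UNIV) UNIV) free_boundary"

definition boundary_borel :: "(nat \<Rightarrow> 'a letter) measure" where
  "boundary_borel = sigma free_boundary {U. openin boundary_topology U}"

definition boundary_Cons :: "'a letter \<Rightarrow> (nat \<Rightarrow> 'a letter) \<Rightarrow> (nat \<Rightarrow> 'a letter)" where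
  "boundary_Cons x \<omega> = (if \<omega> 0 = inv_letter x then (\<lambda>n. \<omega> (Suc n)) else case_nat x \<omega>)"

text \<open>
  Concatenation of a finite word with an infinite reduced word, followed by free reduction.
  The letters of the finite word are prepended one at a time, starting from the last one,
  with a cancellation whenever it is possible.
\<close>

definition boundary_act :: "'a letter list \<Rightarrow> (nat \<Rightarrow> 'a letter) \<Rightarrow> (nat \<Rightarrow> 'a letter)" where
  "boundary_act g \<omega> = foldr boundary_Cons g \<omega>"

definition cylinder :: "'a letter list \<Rightarrow> (nat \<Rightarrow> 'a letter) set" where
  "cylinder g = {\<omega> \<in> free_boundary. \<forall>i<length g. \<omega> i = g ! i}"

text \<open>The conditions below determine the measure uniquely.\<close>

definition is_uniform_boundary_measure :: "(nat \<Rightarrow> 'a::finite letter) measure \<Rightarrow> bool" where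
  "is_uniform_boundary_measure M \<longleftrightarrow>
     prob_space M \<and> space M = free_boundary \<and> sets M = sets boundary_borel \<and>
     (\<forall>g\<in>carrier free_group. g \<noteq> \<one>\<^bsub>free_group\<^esub> \<longrightarrow>
        measure M (cylinder g) =
          1 / (2 * real CARD('a) * (2 * real CARD('a) - 1) ^ (length g - 1)))"

text \<open>
  Conservativity of an action \<open>act\<close> of the group \<open>G\<close> on the measure space \<open>M\<close>. The notion
  is meant for measure class preserving actions of countable groups; this is not part of the
  condition below.
\<close>

definition conservative_action ::
  "('g, 'b) monoid_scheme \<Rightarrow> ('g \<Rightarrow> 'x \<Rightarrow> 'x) \<Rightarrow> 'x measure \<Rightarrow> bool" where
  "conservative_action G act M \<longleftrightarrow>
     (\<forall>A\<in>sets M. emeasure M A > 0 \<longrightarrow>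
        (AE x in M. x \<in> A \<longrightarrow> x \<in> (\<Union>g\<in>carrier G - {\<one>\<^bsub>G\<^esub>}. act g ` A)))"

text \<open>
  Graphs enter only through their graph distances, so loops and multiple edges are irrelevant
  and a graph is given by its edge relation; both relations below are symmetric, because the
  inverse of every letter is again a letter. The relation \<open>E ^^ n\<close> holds between the
  endpoints of paths of length \<open>n\<close>.
\<close>

definition graph_sphere :: "('v \<times> 'v) set \<Rightarrow> 'v \<Rightarrow> nat \<Rightarrow> 'v set" where
  "graph_sphere E x n = {y. (x, y) \<in> E ^^ n \<and> (\<forall>k<n. (x, y) \<notin> E ^^ k)}"

definition cayley_edges :: "('a letter list \<times> 'a letter list) set" where
  "cayley_edges = {(g, g \<otimes>\<^bsub>free_group\<^esub> [a]) | g a. g \<in> carrier free_group}"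

definition schreier_edges ::
  "'a letter list set \<Rightarrow> ('a letter list set \<times> 'a letter list set) set" where
  "schreier_edges H = {(x, x #>\<^bsub>free_group\<^esub> [a]) | x a. x \<in> rcosets\<^bsub>free_group\<^esub> H}"

definition free_sphere :: "nat \<Rightarrow> 'a letter list set" where
  "free_sphere n = graph_sphere cayley_edges \<one>\<^bsub>free_group\<^esub> n"

definition schreier_sphere :: "'a letter list set \<Rightarrow> nat \<Rightarrow> 'a letter list set set" where
  "schreier_sphere H n = graph_sphere (schreier_edges H) H n"

end

theory Submission
  imports Defs
begin

text \<open>
  Choose in every coset of \<open>H\<close> the minimal reduced word for the length-lexicographic order. These
  words are closed under prefixes, so they form a geodesic spanning tree of the Schreier graph;
  the tree has \<open>|S_X^n|\<close> words of length \<open>n\<close>, and the set \<open>\<Omega>\<close> of boundary points all of whose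
  prefixes lie in the tree therefore has measure \<open>lim |S_X^n| / |S_F^n|\<close>.

  The translates of \<open>\<Omega>\<close> are pairwise disjoint, so \<open>\<Omega>\<close> is null if the action is conservative.
  Conversely, a point outside \<open>H \<Omega>\<close> admits infinitely many \<open>h\<close> in \<open>H\<close> whose Radon--Nikodym
  derivative at it is at least 1. By the Borel--Cantelli lemma almost no point of a set with
  disjoint translates has this property; so if \<open>\<Omega>\<close> is null, all such sets are null.
\<close>

section \<open>The free group\<close>

lemma inv_letter_inv_letter [simp]: "inv_letter (inv_letter x) = x"
  by (simp add: inv_letter_def)

lemma inv_letter_neq [simp]: "inv_letter x \<noteq> x"
  by (auto simp: inv_letter_def prod_eq_iff)

lemma reduced_Nil [simp]: "reduced []"
  by (simp add: reduced_def)

lemma reduced_Cons: "reduced (x # w) \<longleftrightarrow> (w = [] \<or> hd w \<noteq> inv_letter x) \<and> reduced w"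
  by (auto simp: reduced_def successively_Cons)

lemma reduced_appendD: "reduced (u @ v) \<Longrightarrow> reduced u"
  by (auto simp: reduced_def successively_append_iff)

lemma reduced_reduce_Cons: "reduced w \<Longrightarrow> reduced (reduce_Cons x w)"
  by (cases w) (auto simp: reduce_Cons_def reduced_Cons)

lemma reduced_foldr_reduce_Cons: "reduced w \<Longrightarrow> reduced (foldr reduce_Cons u w)"
  by (induction u) (auto intro: reduced_reduce_Cons)

lemma reduced_reduce [simp]: "reduced (reduce u)"
  by (simp add: reduce_def reduced_foldr_reduce_Cons)

section \<open>Free reduction and concatenation\<close>

lemma reduce_Nil [simp]: "reduce [] = []"
  by (simp add: reduce_def)

lemma reduce_Cons_eq: "reduce (x # u) = reduce_Cons x (reduce u)"
  by (simp add: reduce_def)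

lemma reduce_reduced: "reduced w \<Longrightarrow> reduce w = w"
  by (induction w) (auto simp: reduce_Cons_eq reduce_Cons_def reduced_Cons)

text \<open>If \<open>w\<close> starts with \<open>x\<close>, the inner step deletes that letter and
  the outer one restores it, since reducedness keeps the next letter from being
  \<open>inv_letter x\<close>.\<close>

lemma reduce_Cons_inv_cancel:
  "reduced w \<Longrightarrow> reduce_Cons x (reduce_Cons (inv_letter x) w) = w"
  by (cases w) (auto simp: reduce_Cons_def reduced_Cons)

text \<open>Adjacent inverse letters act trivially on reduced words, so only the reduced form of a
  prefix matters. Associativity of the product rests on this.\<close>

lemma foldr_reduce_Cons_reduce:
  assumes "reduced w"
  shows "foldr reduce_Cons (reduce u) w = foldr reduce_Cons u w"
proof (induction u)
  case (Cons x u)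
  show ?case
  proof (cases "reduce u \<noteq> [] \<and> hd (reduce u) = inv_letter x")
    case True
    then obtain t where t: "reduce u = inv_letter x # t"
      by (metis list.collapse)
    have "foldr reduce_Cons (x # u) w
        = reduce_Cons x (reduce_Cons (inv_letter x) (foldr reduce_Cons t w))"
      using Cons by (simp add: t)
    also have "\<dots> = foldr reduce_Cons t w"
      using assms by (simp add: reduce_Cons_inv_cancel reduced_foldr_reduce_Cons)
    finally have "foldr reduce_Cons (x # u) w = foldr reduce_Cons t w" .
    moreover have "reduce (x # u) = t"
      by (simp add: reduce_Cons_eq reduce_Cons_def t)
    ultimately show ?thesis by simp
  next
    case False
    then have "reduce (x # u) = x # reduce u"
      by (auto simp: reduce_Cons_eq reduce_Cons_def)
    then show ?thesis using Cons by simp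
  qed
qed simp

lemma reduce_append: "reduce (u @ v) = foldr reduce_Cons u (reduce v)"
  by (simp add: reduce_def)

lemma reduce_append_reduce_left [simp]: "reduce (reduce u @ v) = reduce (u @ v)"
  by (simp add: reduce_append foldr_reduce_Cons_reduce)

lemma reduce_append_reduce_right [simp]: "reduce (u @ reduce v) = reduce (u @ v)"
  by (simp add: reduce_append reduce_reduced)

text \<open>Every cancellation costs two letters. The minimality argument for prefixes uses this
  dichotomy.\<close>

lemma reduce_eq_or_shorter: "reduce u = u \<or> length (reduce u) < length u"
proof (induction u)
  case (Cons x u)
  then show ?case
    by (cases "reduce u") (auto simp: reduce_Cons_eq reduce_Cons_def)
qed simp

lemma length_reduce_le: "length (reduce u) \<le> length u"
  using reduce_eq_or_shorter[of u] by auto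

lemma reduce_inverse_word: "reduce (rev (map inv_letter u) @ u) = []"
proof (induction u)
  case (Cons x u)
  have "reduce (rev (map inv_letter (x # u)) @ x # u)
      = foldr reduce_Cons (rev (map inv_letter u))
          (reduce_Cons (inv_letter x) (reduce_Cons x (reduce u)))"
    by (simp add: reduce_append reduce_Cons_eq)
  also have "\<dots> = reduce (rev (map inv_letter u) @ u)"
    using reduce_Cons_inv_cancel[of "reduce u" "inv_letter x"] by (simp add: reduce_append)
  finally show ?case using Cons by simp
qed simp

section \<open>The group structure\<close>

lemma carrier_free_group [simp]: "w \<in> carrier free_group \<longleftrightarrow> reduced w"
  and one_free_group [simp]: "\<one>\<^bsub>free_group\<^esub> = []"
  and mult_free_group: "g \<otimes>\<^bsub>free_group\<^esub> h = reduce (g @ h)"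
  by (simp_all add: free_group_def)

lemma group_free_group: "group free_group"
proof (rule groupI)
  fix x y z :: "'a letter list"
  assume "x \<in> carrier free_group" "y \<in> carrier free_group" "z \<in> carrier free_group"
  show "x \<otimes>\<^bsub>free_group\<^esub> y \<otimes>\<^bsub>free_group\<^esub> z = x \<otimes>\<^bsub>free_group\<^esub> (y \<otimes>\<^bsub>free_group\<^esub> z)"
    by (simp add: mult_free_group)
next
  fix x :: "'a letter list"
  assume "x \<in> carrier free_group"
  show "\<exists>y\<in>carrier free_group. y \<otimes>\<^bsub>free_group\<^esub> x = \<one>\<^bsub>free_group\<^esub>"
    by (rule bexI[of _ "reduce (rev (map inv_letter x))"])
      (simp_all add: mult_free_group reduce_inverse_word)
qed (auto simp: mult_free_group reduce_reduced)

interpretation free_group: group free_group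
  by (rule group_free_group)

section \<open>The boundary action\<close>

abbreviation initial_word :: "nat \<Rightarrow> (nat \<Rightarrow> 'b) \<Rightarrow> 'b list" where
  "initial_word n \<omega> \<equiv> map \<omega> [0..<n]"

definition append_seq :: "'b list \<Rightarrow> (nat \<Rightarrow> 'b) \<Rightarrow> nat \<Rightarrow> 'b" where
  "append_seq w \<omega> i = (if i < length w then w ! i else \<omega> (i - length w))"

lemma append_seq_initial_word: "append_seq (initial_word n \<omega>) (\<lambda>i. \<omega> (n + i)) = \<omega>"
  by (rule ext) (auto simp: append_seq_def)

lemma initial_word_append_seq: "initial_word (length w) (append_seq w \<omega>) = w"
  by (rule nth_equalityI) (auto simp: append_seq_def)

text \<open>With \<open>w\<close> nonempty any cancellation happens inside \<open>w\<close>; for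
  empty \<open>w\<close> it could consume the first letter of \<open>\<omega>\<close>.\<close>

lemma boundary_Cons_append_seq:
  assumes "w \<noteq> []"
  shows "boundary_Cons x (append_seq w \<omega>) = append_seq (reduce_Cons x w) \<omega>"
  using assms
  by (cases w)
    (auto simp: boundary_Cons_def reduce_Cons_def append_seq_def fun_eq_iff split: nat.splits)

lemma reduced_initial_word: "\<omega> \<in> free_boundary \<Longrightarrow> reduced (initial_word n \<omega>)"
  by (auto simp: reduced_def free_boundary_def successively_conv_nth)

lemma boundary_Cons_in_boundary:
  "\<omega> \<in> free_boundary \<Longrightarrow> boundary_Cons x \<omega> \<in> free_boundary"
  by (auto simp: free_boundary_def boundary_Cons_def split: nat.splits)

lemma boundary_Cons_inv_cancel:
  assumes "\<omega> \<in> free_boundary"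
  shows "boundary_Cons x (boundary_Cons (inv_letter x) \<omega>) = \<omega>"
proof (cases "\<omega> 0 = x")
  case True
  then have "\<omega> (Suc 0) \<noteq> inv_letter x"
    using assms by (auto simp: free_boundary_def)
  then show ?thesis using True
    by (auto simp: boundary_Cons_def fun_eq_iff split: nat.splits)
qed (auto simp: boundary_Cons_def)

lemma boundary_act_Nil [simp]: "boundary_act [] \<omega> = \<omega>"
  and boundary_act_Cons [simp]: "boundary_act (x # g) \<omega> = boundary_Cons x (boundary_act g \<omega>)"
  by (simp_all add: boundary_act_def)

lemma boundary_act_in_boundary:
  "\<omega> \<in> free_boundary \<Longrightarrow> boundary_act g \<omega> \<in> free_boundary"
  by (induction g) (auto intro: boundary_Cons_in_boundary)

text \<open>The same cancellation argument as for finite words; it makes the letterwise definition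
  an action of the group.\<close>

lemma boundary_act_reduce:
  assumes "\<omega> \<in> free_boundary"
  shows "boundary_act (reduce g) \<omega> = boundary_act g \<omega>"
proof (induction g)
  case (Cons x g)
  show ?case
  proof (cases "reduce g \<noteq> [] \<and> hd (reduce g) = inv_letter x")
    case True
    then obtain t where t: "reduce g = inv_letter x # t"
      by (metis list.collapse)
    have "boundary_act (x # g) \<omega> = boundary_act t \<omega>"
      using Cons[symmetric] boundary_act_in_boundary[OF assms]
      by (simp add: t boundary_Cons_inv_cancel)
    then show ?thesis by (simp add: reduce_Cons_eq reduce_Cons_def t)
  next
    case False
    then have "reduce (x # g) = x # reduce g"
      by (auto simp: reduce_Cons_eq reduce_Cons_def)
    then show ?thesis using Cons by simp
  qed
qed simp

lemma boundary_act_mult: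
  "\<omega> \<in> free_boundary \<Longrightarrow>
    boundary_act (g \<otimes>\<^bsub>free_group\<^esub> h) \<omega> = boundary_act g (boundary_act h \<omega>)"
  by (simp add: mult_free_group boundary_act_reduce) (simp add: boundary_act_def)

lemma boundary_act_inv:
  assumes "\<omega> \<in> free_boundary" "reduced g"
  shows "boundary_act (inv\<^bsub>free_group\<^esub> g) (boundary_act g \<omega>) = \<omega>"
    and "boundary_act g (boundary_act (inv\<^bsub>free_group\<^esub> g) \<omega>) = \<omega>"
  using assms by (simp_all flip: boundary_act_mult)

text \<open>Done letter by letter, since \<open>g\<close> need not be reduced and so need not have
  an inverse in the group.\<close>

lemma inj_on_boundary_act: "inj_on (boundary_act g) free_boundary"
proof (induction g)
  case (Cons x g)
  have "inj_on (boundary_Cons x) free_boundary"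
    by (rule inj_on_inverseI[of _ "boundary_Cons (inv_letter x)"])
      (use boundary_Cons_inv_cancel[of _ "inv_letter x"] in simp)
  with Cons have "inj_on (boundary_Cons x \<circ> boundary_act g) free_boundary"
    by (intro comp_inj_on) (auto elim!: inj_on_subset intro: boundary_act_in_boundary)
  then show ?case by (simp add: comp_def)
qed (simp add: inj_on_def)

text \<open>
  The Busemann cocycle of the tree: the logarithm, to the base \<open>2 * CARD('a) - 1\<close>, of the
  Radon--Nikodym derivative of the action of \<open>g\<close> on the uniform measure.
\<close>

primrec busemann :: "'a letter list \<Rightarrow> (nat \<Rightarrow> 'a letter) \<Rightarrow> int" where
  "busemann [] \<omega> = 0"
| "busemann (x # g) \<omega> =
     busemann g \<omega> + (if boundary_act g \<omega> 0 = inv_letter x then 1 else - 1)"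

lemma busemann_ge: "- int (length g) \<le> busemann g \<omega>"
  by (induction g) auto

text \<open>An initial word at least as long as \<open>g\<close> absorbs all cancellations, so the
  tail is only shifted, and \<open>busemann g \<omega>\<close> is the net number of letters lost.
  The last bound keeps the word nonempty before each new letter in the induction.\<close>

lemma boundary_act_initial_word:
  assumes "\<omega> \<in> free_boundary" "length g \<le> n"
  defines "w \<equiv> reduce (g @ initial_word n \<omega>)"
  shows "boundary_act g \<omega> = append_seq w (\<lambda>i. \<omega> (n + i))"
    and "int (length w) = int n - busemann g \<omega>"
    and "n \<le> length g + length w"
proof -
  have "boundary_act g \<omega> = append_seq w (\<lambda>i. \<omega> (n + i))
     \<and> int (length w) = int n - busemann g \<omega> \<and> n \<le> length g + length w"
    using assms(2) unfolding w_def
  proof (induction g)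
    case Nil
    then show ?case
      using assms(1) by (simp add: reduce_reduced reduced_initial_word append_seq_initial_word)
  next
    case (Cons x g)
    define v where "v = reduce (g @ initial_word n \<omega>)"
    have IH: "boundary_act g \<omega> = append_seq v (\<lambda>i. \<omega> (n + i))"
      "int (length v) = int n - busemann g \<omega>" "n \<le> length g + length v"
      using Cons by (auto simp: v_def)
    have "v \<noteq> []" using IH(3) Cons.prems by auto
    have *: "reduce ((x # g) @ initial_word n \<omega>) = reduce_Cons x v"
      by (simp add: reduce_Cons_eq v_def)
    have "boundary_act (x # g) \<omega> = append_seq (reduce_Cons x v) (\<lambda>i. \<omega> (n + i))"
      using \<open>v \<noteq> []\<close> by (simp add: IH(1) boundary_Cons_append_seq)
    moreover have "boundary_act g \<omega> 0 = hd v"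
      using \<open>v \<noteq> []\<close> by (simp add: IH(1) append_seq_def hd_conv_nth)
    ultimately show ?case
      unfolding * using IH \<open>v \<noteq> []\<close> by (cases v) (auto simp: reduce_Cons_def)
  qed
  then show "boundary_act g \<omega> = append_seq w (\<lambda>i. \<omega> (n + i))"
    and "int (length w) = int n - busemann g \<omega>"
    and "n \<le> length g + length w"
    by auto
qed

section \<open>Minimal Schreier transversals and spheres\<close>

text \<open>Only two properties of this order matter: totality makes minimal representatives unique,
  well-foundedness makes them exist.\<close>

definition letter_order :: "('a::finite letter \<times> 'a letter) set" where
  "letter_order = inv_image less_than to_nat"

definition schreier_transversal :: "'a::finite letter list set \<Rightarrow> 'a letter list set" where
  "schreier_transversal H =
     {w. reduced w \<and> (\<forall>v\<in>H #>\<^bsub>free_group\<^esub> w. (v, w) \<notin> lenlex letter_order)}"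

lemma wf_lenlex_letter_order: "wf (lenlex letter_order)"
  by (simp add: letter_order_def wf_lenlex)

lemma total_lenlex_letter_order: "total (lenlex (letter_order :: ('a::finite letter \<times> 'a letter) set))"
proof (rule total_lenlex)
  show "total (letter_order :: ('a::finite letter \<times> 'a letter) set)"
    unfolding letter_order_def total_on_def
  proof (intro ballI impI)
    fix x y :: "'a letter"
    assume "x \<noteq> y"
    then have "to_nat x \<noteq> to_nat y" by simp
    then show "(x, y) \<in> inv_image less_than to_nat \<or> (y, x) \<in> inv_image less_than to_nat"
      by (simp only: in_inv_image less_than_iff neq_iff)
  qed
qed

context
  fixes H :: "'a::finite letter list set"
  assumes H: "subgroup H free_group"
begin

lemma reduced_subgroup: "h \<in> H \<Longrightarrow> reduced h"
  using subgroup.mem_carrier[OF H] by simp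

lemma coset_reduced: "v \<in> H #>\<^bsub>free_group\<^esub> w \<Longrightarrow> reduced v"
  by (auto simp: r_coset_def mult_free_group)

lemma coset_eq:
  "v \<in> H #>\<^bsub>free_group\<^esub> w \<Longrightarrow> reduced w \<Longrightarrow> H #>\<^bsub>free_group\<^esub> v = H #>\<^bsub>free_group\<^esub> w"
  using free_group.repr_independence[OF _ _ H, of v w] by simp

text \<open>Two distinct representatives of one coset are comparable, and the larger one cannot be
  minimal.\<close>

lemma schreier_transversal_unique:
  assumes "v \<in> schreier_transversal H" "w \<in> schreier_transversal H"
    and "v \<in> H #>\<^bsub>free_group\<^esub> w"
  shows "v = w"
proof (rule ccontr)
  assume "v \<noteq> w"
  moreover have "w \<in> H #>\<^bsub>free_group\<^esub> v"
    using assms coset_eq[of v w] free_group.rcos_self[OF _ H, of w]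
    by (auto simp: schreier_transversal_def)
  ultimately show False
    using assms total_lenlex_letter_order
    by (auto simp: schreier_transversal_def total_on_def)
qed

text \<open>Since length is compared first, a minimal element is also shortest in its coset, which
  makes the spanning tree geodesic.\<close>

lemma schreier_transversal_exists:
  assumes "reduced w"
  obtains t where "t \<in> schreier_transversal H" "t \<in> H #>\<^bsub>free_group\<^esub> w" "length t \<le> length w"
proof -
  have w: "w \<in> H #>\<^bsub>free_group\<^esub> w"
    using free_group.rcos_self[OF _ H, of w] assms by simp
  obtain t where t: "t \<in> H #>\<^bsub>free_group\<^esub> w"
    "\<And>v. (v, t) \<in> lenlex letter_order \<Longrightarrow> v \<notin> H #>\<^bsub>free_group\<^esub> w"
    using wfE_min[OF wf_lenlex_letter_order w] by metis
  have "t \<in> schreier_transversal H"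
    using t coset_eq[OF t(1) assms] coset_reduced by (auto simp: schreier_transversal_def)
  moreover have "length t \<le> length w"
    using t(2)[of w] w by (force simp: lenlex_conv)
  ultimately show ?thesis using t(1) that by blast
qed

text \<open>Replacing the prefix \<open>u\<close> by a smaller \<open>u'\<close> of its coset stays
  in the coset of \<open>u @ v\<close> and would make that word smaller too.\<close>

lemma schreier_transversal_prefix:
  assumes "u @ v \<in> schreier_transversal H"
  shows "u \<in> schreier_transversal H"
proof -
  have uv: "reduced (u @ v)" using assms by (simp add: schreier_transversal_def)
  have "(u', u) \<notin> lenlex letter_order" if "u' \<in> H #>\<^bsub>free_group\<^esub> u" for u'
  proof
    assume less: "(u', u) \<in> lenlex letter_order"
    obtain h where h: "h \<in> H" "u' = h \<otimes>\<^bsub>free_group\<^esub> u"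
      using \<open>u' \<in> H #>\<^bsub>free_group\<^esub> u\<close> by (auto simp: r_coset_def)
    define w where "w = reduce (u' @ v)"
    have "w = h \<otimes>\<^bsub>free_group\<^esub> (u @ v)"
      by (simp add: w_def h(2) mult_free_group)
    then have "w \<in> H #>\<^bsub>free_group\<^esub> (u @ v)"
      using h(1) by (auto simp: r_coset_def)
    then have nless: "(w, u @ v) \<notin> lenlex letter_order"
      using assms by (simp add: schreier_transversal_def)
    \<comment> \<open>Both a shorter \<open>u'\<close> and any cancellation with \<open>v\<close>
      would make \<open>w\<close> shorter than \<open>u @ v\<close>. So the lengths agree, and the
      lexicographic comparison survives appending \<open>v\<close>.\<close>
    have "length u' \<le> length u" using less by (auto simp: lenlex_conv)
    with reduce_eq_or_shorter[of "u' @ v"] nless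
    have "w = u' @ v" "length u' = length u"
      by (auto simp: lenlex_conv w_def)
    then show False
      using less nless by (auto simp: lenlex_conv lex_append_rightI)
  qed
  then show ?thesis
    using reduced_appendD[OF uv] by (simp add: schreier_transversal_def)
qed

section \<open>Spheres of the Schreier graph and of the Cayley graph\<close>

lemma schreier_path_iff:
  "(H, y) \<in> schreier_edges H ^^ n \<longleftrightarrow>
     (\<exists>u. length u = n \<and> y = H #>\<^bsub>free_group\<^esub> reduce u)"
proof (induction n arbitrary: y)
  case 0
  have "H #>\<^bsub>free_group\<^esub> [] = H"
    using free_group.coset_mult_one[OF subgroup.subset[OF H]] by simp
  then show ?case by auto
next
  case (Suc n)
  have step: "H #>\<^bsub>free_group\<^esub> reduce (u @ [a]) = (H #>\<^bsub>free_group\<^esub> reduce u) #>\<^bsub>free_group\<^esub> [a]"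
    for u :: "'a letter list" and a
    using free_group.coset_mult_assoc[OF subgroup.subset[OF H], of "reduce u" "[a]"]
    by (simp add: mult_free_group reduced_Cons)
  have vertex: "H #>\<^bsub>free_group\<^esub> reduce u \<in> rcosets\<^bsub>free_group\<^esub> H" for u
    by (rule free_group.rcosetsI[OF subgroup.subset[OF H]]) simp
  have "(H, y) \<in> schreier_edges H ^^ Suc n \<longleftrightarrow>
      (\<exists>u a. length u = n \<and> y = (H #>\<^bsub>free_group\<^esub> reduce u) #>\<^bsub>free_group\<^esub> [a])"
  proof -
    have "(H #>\<^bsub>free_group\<^esub> reduce u, y) \<in> schreier_edges H \<longleftrightarrow>
        (\<exists>a. y = (H #>\<^bsub>free_group\<^esub> reduce u) #>\<^bsub>free_group\<^esub> [a])" for u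
      using vertex[of u] by (auto simp: schreier_edges_def)
    then show ?thesis
      by (auto simp: relcomp_unfold Suc.IH)
  qed
  also have "\<dots> \<longleftrightarrow> (\<exists>u a. length u = n \<and> y = H #>\<^bsub>free_group\<^esub> reduce (u @ [a]))"
    by (simp add: step)
  also have "\<dots> \<longleftrightarrow> (\<exists>u. length u = Suc n \<and> y = H #>\<^bsub>free_group\<^esub> reduce u)"
    by (simp add: length_Suc_conv_rev) blast
  finally show ?case .
qed

text \<open>Paths from the origin spell words, so the distance to a coset is the least length of a
  word in it, and the minimal representative attains it.\<close>

lemma card_schreier_sphere:
  "card (schreier_sphere H n) = card {w \<in> schreier_transversal H. length w = n}"
proof -
  let ?T = "{w \<in> schreier_transversal H. length w = n}"
  have "bij_betw (\<lambda>w. H #>\<^bsub>free_group\<^esub> w) ?T (schreier_sphere H n)"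
    unfolding bij_betw_def
  proof (intro conjI equalityI subsetI)
    show "inj_on (\<lambda>w. H #>\<^bsub>free_group\<^esub> w) ?T"
    proof (rule inj_onI)
      fix v w assume "v \<in> ?T" "w \<in> ?T" "H #>\<^bsub>free_group\<^esub> v = H #>\<^bsub>free_group\<^esub> w"
      then show "v = w"
        using schreier_transversal_unique[of v w] free_group.rcos_self[OF _ H, of v]
        by (auto simp: schreier_transversal_def)
    qed
  next
    fix y assume "y \<in> (\<lambda>w. H #>\<^bsub>free_group\<^esub> w) ` ?T"
    then obtain w where w: "w \<in> schreier_transversal H" "length w = n" "y = H #>\<^bsub>free_group\<^esub> w"
      by auto
    have red: "reduced w" using w(1) by (simp add: schreier_transversal_def)
    have "y \<noteq> H #>\<^bsub>free_group\<^esub> reduce u" if "length u < n" for u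
    proof
      assume "y = H #>\<^bsub>free_group\<^esub> reduce u"
      then have "reduce u \<in> H #>\<^bsub>free_group\<^esub> w"
        using free_group.rcos_self[OF _ H, of "reduce u"] w(3) by simp
      moreover have "(reduce u, w) \<in> lenlex letter_order"
        using that length_reduce_le[of u] w(2) by (auto simp: lenlex_conv)
      ultimately show False using w(1) by (auto simp: schreier_transversal_def)
    qed
    moreover have "\<exists>u. length u = n \<and> y = H #>\<^bsub>free_group\<^esub> reduce u"
      using w red by (intro exI[of _ w]) (simp add: reduce_reduced)
    ultimately show "y \<in> schreier_sphere H n"
      by (auto simp: schreier_sphere_def graph_sphere_def schreier_path_iff)
  next
    fix y assume "y \<in> schreier_sphere H n"
    then obtain u where u: "length u = n" "y = H #>\<^bsub>free_group\<^esub> reduce u"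
      and far: "\<And>v. length v < n \<Longrightarrow> y \<noteq> H #>\<^bsub>free_group\<^esub> reduce v"
      by (auto simp: schreier_sphere_def graph_sphere_def schreier_path_iff)
    obtain t where t: "t \<in> schreier_transversal H" "t \<in> H #>\<^bsub>free_group\<^esub> reduce u"
      "length t \<le> length (reduce u)"
      using schreier_transversal_exists[of "reduce u"] by auto
    have y: "y = H #>\<^bsub>free_group\<^esub> t"
      using coset_eq[OF t(2)] u(2) by simp
    have "length t \<le> n" using t(3) length_reduce_le[of u] u(1) by simp
    moreover have "\<not> length t < n"
      using far[of t] y t(1) by (auto simp: reduce_reduced schreier_transversal_def)
    ultimately show "y \<in> (\<lambda>w. H #>\<^bsub>free_group\<^esub> w) ` ?T"
      using t(1) y by auto
  qed
  then show ?thesis by (simp add: bij_betw_same_card)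
qed

end

lemma cayley_path_iff:
  "([], g) \<in> cayley_edges ^^ n \<longleftrightarrow> (\<exists>u. length u = n \<and> g = reduce u)"
proof (induction n arbitrary: g)
  case (Suc n)
  have "([], g) \<in> cayley_edges ^^ Suc n \<longleftrightarrow>
      (\<exists>u a. length u = n \<and> g = reduce (u @ [a]))"
  proof -
    have "(reduce u, g) \<in> cayley_edges \<longleftrightarrow> (\<exists>a. g = reduce (u @ [a]))" for u
      by (auto simp: cayley_edges_def mult_free_group)
    then show ?thesis
      by (auto simp: relcomp_unfold Suc.IH)
  qed
  also have "\<dots> \<longleftrightarrow> (\<exists>u. length u = Suc n \<and> g = reduce u)"
    by (simp add: length_Suc_conv_rev) blast
  finally show ?case .
qed auto

lemma free_sphere_eq: "free_sphere n = {w. reduced w \<and> length w = n}"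
proof (intro equalityI subsetI)
  fix w assume "w \<in> free_sphere n"
  then obtain u where u: "length u = n" "w = reduce u"
    and far: "\<And>v. length v < n \<Longrightarrow> w \<noteq> reduce v"
    by (auto simp: free_sphere_def graph_sphere_def cayley_path_iff)
  then show "w \<in> {w. reduced w \<and> length w = n}"
    using length_reduce_le[of u] far[of w] by (auto simp: reduce_reduced le_less)
next
  fix w :: "'a letter list" assume w: "w \<in> {w. reduced w \<and> length w = n}"
  then have "w \<noteq> reduce v" if "length v < n" for v
    using length_reduce_le[of v] that by auto
  moreover have "\<exists>u. length u = n \<and> w = reduce u"
    using w by (intro exI[of _ w]) (simp add: reduce_reduced)
  ultimately show "w \<in> free_sphere n"
    by (auto simp: free_sphere_def graph_sphere_def cayley_path_iff)
qed

section \<open>Scaling of the uniform measure\<close>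

lemma cylinder_Nil [simp]: "cylinder [] = free_boundary"
  by (simp add: cylinder_def)

lemma cylinder_subset: "cylinder w \<subseteq> free_boundary"
  by (auto simp: cylinder_def)

lemma mem_cylinder_iff:
  "\<omega> \<in> cylinder w \<longleftrightarrow> \<omega> \<in> free_boundary \<and> initial_word (length w) \<omega> = w"
  unfolding cylinder_def
  using list_eq_iff_nth_eq[of "initial_word (length w) \<omega>" w] by auto

lemma mem_cylinder_Cons:
  "\<omega> \<in> cylinder (x # w) \<longleftrightarrow>
     \<omega> \<in> free_boundary \<and> \<omega> 0 = x \<and> (\<forall>i<length w. \<omega> (Suc i) = w ! i)"
  by (auto simp: cylinder_def nth_Cons split: nat.splits)

lemma cylinder_not_reduced: "\<not> reduced w \<Longrightarrow> cylinder w = {}"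
  using reduced_initial_word by (metis equals0I mem_cylinder_iff)

text \<open>Cylinders are nested or disjoint, and the empty set is itself the cylinder of a
  non-reduced word.\<close>

lemma Int_stable_cylinder: "Int_stable (range (cylinder :: 'a letter list \<Rightarrow> _))"
proof -
  have empty: "{} \<in> range (cylinder :: 'a letter list \<Rightarrow> _)"
  proof
    show "{} = cylinder [x, inv_letter x]" for x :: "'a letter"
      by (rule cylinder_not_reduced[symmetric]) (simp add: reduced_Cons)
  qed simp
  have le: "cylinder v \<inter> cylinder w \<in> range cylinder"
    if len: "length v \<le> length w" for v w :: "'a letter list"
  proof (cases "take (length v) w = v")
    case True
    then have "v ! i = w ! i" if "i < length v" for i
      using that by (metis nth_take)
    then have "cylinder v \<inter> cylinder w = cylinder w"
      using \<open>length v \<le> length w\<close> by (auto simp: cylinder_def)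
    then show ?thesis by simp
  next
    case False
    then obtain i where "i < length v" "v ! i \<noteq> w ! i"
      using len by (auto simp: list_eq_iff_nth_eq)
    then have "cylinder v \<inter> cylinder w = {}"
      using len by (force simp: cylinder_def)
    then show ?thesis using empty by simp
  qed
  show ?thesis
    unfolding Int_stable_def
  proof safe
    fix v w :: "'a letter list"
    show "cylinder v \<inter> cylinder w \<in> range cylinder"
      using le[of v w] le[of w v] by (cases "length v \<le> length w") (auto simp: Int_commute)
  qed
qed

lemma openin_cylinder: "openin boundary_topology (cylinder w)"
proof -
  define U where "U = (\<lambda>i. if i < length w then {w ! i} else UNIV)"
  have "openin (product_topology (\<lambda>_. discrete_topology UNIV) UNIV) (Pi\<^sub>E UNIV U)"
    by (subst openin_PiE_gen) (auto simp: U_def)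
  moreover have "cylinder w = Pi\<^sub>E UNIV U \<inter> free_boundary"
    by (auto simp: cylinder_def U_def PiE_iff split: if_splits)
  ultimately show ?thesis
    by (auto simp: boundary_topology_def openin_subtopology)
qed

text \<open>A basic open set restricts finitely many coordinates; \<open>n\<close> lies beyond all
  of them.\<close>

lemma open_contains_cylinder:
  assumes "openin boundary_topology S" "\<omega> \<in> S"
  obtains n where "cylinder (initial_word n \<omega>) \<subseteq> S"
proof -
  obtain T where T: "openin (product_topology (\<lambda>_. discrete_topology UNIV) UNIV) T"
    "S = T \<inter> free_boundary"
    using assms(1) by (auto simp: boundary_topology_def openin_subtopology)
  then obtain U where U: "finite {i. U i \<noteq> UNIV}" "\<omega> \<in> Pi\<^sub>E UNIV U" "Pi\<^sub>E UNIV U \<subseteq> T"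
    using assms(2) by (auto simp: openin_product_topology_alt)
  obtain n where n: "\<And>i. U i \<noteq> UNIV \<Longrightarrow> i < n"
    using U(1) by (auto simp: finite_nat_set_iff_bounded)
  have "cylinder (initial_word n \<omega>) \<subseteq> S"
  proof
    fix \<eta> assume \<eta>: "\<eta> \<in> cylinder (initial_word n \<omega>)"
    have "\<eta> i \<in> U i" for i
      using n[of i] \<eta> U(2) by (cases "i < n") (auto simp: cylinder_def PiE_iff)
    then show "\<eta> \<in> S"
      using U(3) T(2) \<eta> by (auto simp: cylinder_def PiE_iff)
  qed
  then show ?thesis by (rule that)
qed

text \<open>There are only countably many words, so every open set is a countable union of
  cylinders.\<close>

lemma sets_boundary_borel:
  "sets boundary_borel = sigma_sets free_boundary (range (cylinder :: 'a::finite letter list \<Rightarrow> _))"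
proof -
  have sub: "{U. openin boundary_topology U} \<subseteq> Pow (free_boundary :: (nat \<Rightarrow> 'a letter) set)"
    by (auto simp: boundary_topology_def openin_subtopology)
  have "sigma_sets free_boundary {U. openin boundary_topology U}
      = sigma_sets free_boundary (range (cylinder :: 'a letter list \<Rightarrow> _))"
  proof (rule sigma_sets_eqI)
    fix S :: "(nat \<Rightarrow> 'a letter) set"
    assume S: "S \<in> {U. openin boundary_topology U}"
    define W where "W = {w. cylinder w \<subseteq> S}"
    have "S = (\<Union>w\<in>W. cylinder w)"
    proof (intro equalityI subsetI)
      fix \<omega> assume "\<omega> \<in> S"
      moreover obtain n where "cylinder (initial_word n \<omega>) \<subseteq> S"
        using S \<open>\<omega> \<in> S\<close> open_contains_cylinder by blast
      ultimately show "\<omega> \<in> (\<Union>w\<in>W. cylinder w)"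
        using S sub by (auto simp: W_def mem_cylinder_iff intro!: exI[of _ "initial_word n \<omega>"])
    qed (auto simp: W_def)
    then have S_eq: "S = \<Union> (cylinder ` W)" by simp
    have "\<Union> (cylinder ` W) \<in> sigma_sets free_boundary (range cylinder)"
      by (rule sigma_sets_UNION) auto
    then show "S \<in> sigma_sets free_boundary (range cylinder)"
      by (subst S_eq)
  qed (auto intro: openin_cylinder)
  then show ?thesis
    using sub by (simp add: boundary_borel_def)
qed

text \<open>The image point starts with \<open>x\<close> exactly when nothing cancels: after a
  cancellation the next letter is not \<open>x\<close>, by reducedness. Any other first letter must
  have been uncovered by a cancellation.\<close>

lemma boundary_Cons_vimage_cylinder:
  "boundary_Cons x -` cylinder (y # w) \<inter> free_boundary =
     (if y = x then cylinder w - cylinder [inv_letter x] else cylinder (inv_letter x # y # w))"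
    (is "?L = ?R")
proof (rule Set.set_eqI)
  fix \<omega>
  show "\<omega> \<in> ?L \<longleftrightarrow> \<omega> \<in> ?R"
  proof (cases "\<omega> \<in> free_boundary \<and> \<omega> 0 = inv_letter x")
    case True
    then have 1: "\<omega> 1 \<noteq> x"
      by (auto simp: free_boundary_def dest: spec[of _ 0])
    have "boundary_Cons x \<omega> = (\<lambda>n. \<omega> (Suc n))"
      using True by (simp add: boundary_Cons_def)
    moreover have "(\<lambda>n. \<omega> (Suc n)) \<in> free_boundary"
      using True by (auto simp: free_boundary_def)
    ultimately show ?thesis
      using True 1 by (auto simp: mem_cylinder_Cons nth_Cons split: nat.splits)
  next
    case False
    then show ?thesis
      using boundary_Cons_in_boundary[of \<omega> x]
      by (auto simp: mem_cylinder_Cons boundary_Cons_def) (auto simp: cylinder_def)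
  qed
qed

text \<open>Rewriting an image as a preimage under the inverse letter yields measurability of
  images.\<close>

lemma boundary_Cons_image:
  assumes "E \<subseteq> free_boundary"
  shows "boundary_Cons x ` E = boundary_Cons (inv_letter x) -` E \<inter> free_boundary"
proof (intro equalityI subsetI)
  fix \<omega> assume "\<omega> \<in> boundary_Cons x ` E"
  then show "\<omega> \<in> boundary_Cons (inv_letter x) -` E \<inter> free_boundary"
    using assms boundary_Cons_inv_cancel[of _ "inv_letter x"]
    by (auto intro!: boundary_Cons_in_boundary)
next
  fix \<omega> assume "\<omega> \<in> boundary_Cons (inv_letter x) -` E \<inter> free_boundary"
  then show "\<omega> \<in> boundary_Cons x ` E"
    using boundary_Cons_inv_cancel[of \<omega> x] by (auto intro!: image_eqI)
qed

section \<open>The uniform measure under letters and words\<close>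

locale uniform_boundary =
  fixes M :: "(nat \<Rightarrow> 'a::finite letter) measure"
  assumes card_ge_2: "CARD('a) \<ge> 2"
    and uniform: "is_uniform_boundary_measure M"
begin

sublocale prob_space M
  using uniform by (simp add: is_uniform_boundary_measure_def)

text \<open>The Cayley tree is regular of degree \<open>q + 1\<close>: a reduced word has
  \<open>q + 1\<close> choices for its first letter and \<open>q\<close> for each later one.\<close>

definition q :: real where "q = 2 * real CARD('a) - 1"

lemma q_ge: "q \<ge> 3"
  using card_ge_2 by (simp add: q_def)

lemma q_pos: "q > 0"
  using q_ge by simp

lemma space_M: "space M = free_boundary"
  using uniform by (simp add: is_uniform_boundary_measure_def)

lemma sets_M: "sets M = sigma_sets free_boundary (range cylinder)"
  using uniform by (simp add: is_uniform_boundary_measure_def sets_boundary_borel)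

lemma sets_subset: "E \<in> sets M \<Longrightarrow> E \<subseteq> free_boundary"
  using sets.sets_into_space[of E M] by (simp add: space_M)

lemma cylinder_sets [measurable]: "cylinder w \<in> sets M"
  by (auto simp: sets_M)

lemma measure_cylinder:
  "reduced w \<Longrightarrow> w \<noteq> [] \<Longrightarrow> measure M (cylinder w) = 1 / ((q + 1) * q ^ (length w - 1))"
  using uniform by (auto simp: is_uniform_boundary_measure_def q_def)

lemma measurable_boundary_Cons [measurable]: "boundary_Cons x \<in> measurable M M"
proof (rule measurable_sigma_sets[OF sets_M])
  fix S :: "(nat \<Rightarrow> 'a letter) set" assume "S \<in> range cylinder"
  then obtain w where S: "S = cylinder w" by auto
  show "boundary_Cons x -` S \<inter> space M \<in> sets M"
  proof (cases w)
    case Nil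
    then have "boundary_Cons x -` S \<inter> space M = space M"
      by (auto simp: S space_M intro: boundary_Cons_in_boundary)
    then show ?thesis by simp
  next
    case (Cons y v)
    then show ?thesis
      by (simp add: S space_M boundary_Cons_vimage_cylinder)
  qed
qed (use cylinder_subset in \<open>auto simp: space_M intro: boundary_Cons_in_boundary\<close>)

lemma measurable_boundary_act [measurable]: "boundary_act g \<in> measurable M M"
proof (induction g)
  case (Cons x g)
  from measurable_compose[OF Cons measurable_boundary_Cons] show ?case by simp
qed simp

lemma boundary_Cons_image_sets: "E \<in> sets M \<Longrightarrow> boundary_Cons x ` E \<in> sets M"
  using measurable_sets[OF measurable_boundary_Cons]
  by (simp add: boundary_Cons_image sets_subset space_M)

lemma boundary_act_image_sets: "E \<in> sets M \<Longrightarrow> boundary_act g ` E \<in> sets M"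
proof (induction g)
  case (Cons x g)
  then have "boundary_Cons x ` (boundary_act g ` E) \<in> sets M"
    by (intro boundary_Cons_image_sets)
  then show ?case by (simp add: image_image)
qed simp

text \<open>Prepending \<open>x\<close> without cancellation lengthens a cylinder word by one letter
  and so divides its measure by \<open>q\<close>. Agreement on cylinders extends to Borel sets
  because both sides are finite measures in \<open>E\<close>.\<close>

lemma measure_boundary_Cons_vimage:
  assumes "E \<in> sets M"
  shows "measure M (boundary_Cons x -` E \<inter> free_boundary - cylinder [inv_letter x])
    = q * measure M (E \<inter> cylinder [x])"
proof -
  \<comment> \<open>The two sides as measures in \<open>E\<close>: \<open>P\<close> is the
    right-hand one, \<open>Q\<close> the left-hand one.\<close>
  define P where "P = scale_measure (ennreal q) (density M (indicator (cylinder [x])))"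
  define Q where "Q = distr (density M (indicator (free_boundary - cylinder [inv_letter x])))
    M (boundary_Cons x)"
  have boundary: "free_boundary \<in> sets M"
    using sets.top[of M] by (simp add: space_M)
  have P: "emeasure P S = ennreal (q * measure M (S \<inter> cylinder [x]))" if "S \<in> sets M" for S
    using that q_pos unfolding P_def
    by (simp add: emeasure_restricted emeasure_eq_measure ennreal_mult Int_commute)
  have Q: "emeasure Q S =
      ennreal (measure M (boundary_Cons x -` S \<inter> free_boundary - cylinder [inv_letter x]))"
    if "S \<in> sets M" for S
  proof -
    have V: "boundary_Cons x -` S \<inter> free_boundary \<in> sets M"
      using measurable_sets[OF measurable_boundary_Cons that] by (simp add: space_M)
    have "emeasure Q S =
        emeasure (density M (indicator (free_boundary - cylinder [inv_letter x])))
          (boundary_Cons x -` S \<inter> free_boundary)"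
      unfolding Q_def using that
      by (subst emeasure_distr) (auto simp: space_M)
    also have "\<dots> = emeasure M (boundary_Cons x -` S \<inter> free_boundary - cylinder [inv_letter x])"
      using V boundary
      by (subst emeasure_restricted) (auto intro!: arg_cong[where f = "emeasure M"])
    finally show ?thesis by (simp add: emeasure_eq_measure)
  qed
  have letter: "measure M (cylinder [y]) = 1 / (q + 1)" for y
    by (simp add: measure_cylinder reduced_Cons)
  have compl: "measure M (free_boundary - cylinder [inv_letter x]) = q / (q + 1)"
    using finite_measure_compl[OF cylinder_sets, of "[inv_letter x]"] q_pos
    by (simp add: space_M letter prob_space[unfolded space_M] field_simps)
  have "Q = P"
  proof (rule measure_eqI_generator_eq[OF Int_stable_cylinder])
    fix S :: "(nat \<Rightarrow> 'a letter) set" assume "S \<in> range cylinder"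
    then obtain w where S: "S = cylinder w" by auto
    have "measure M (boundary_Cons x -` S \<inter> free_boundary - cylinder [inv_letter x])
        = q * measure M (S \<inter> cylinder [x])"
    proof (cases w)
      case Nil
      have "boundary_Cons x -` S \<inter> free_boundary = free_boundary" "S \<inter> cylinder [x] = cylinder [x]"
        using cylinder_subset[of "[x]"] by (auto simp: S Nil intro: boundary_Cons_in_boundary)
      then show ?thesis by (simp add: compl letter)
    next
      case (Cons y v)
      \<comment> \<open>The tail \<open>v = []\<close> is separate because the cylinder formula does
        not cover the empty word; the value then comes from the complement of a letter cylinder. For
        \<open>y \<noteq> x\<close> and for non-reduced \<open>w\<close> both sides vanish.\<close>
      consider "y \<noteq> x" | "y = x" "v = []" | "y = x" "v \<noteq> []" "\<not> reduced w"
        | "y = x" "v \<noteq> []" "reduced w" by blast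
      then show ?thesis
      proof cases
        case 1
        then have "S \<inter> cylinder [x] = {}"
          "boundary_Cons x -` S \<inter> free_boundary - cylinder [inv_letter x] = {}"
          by (auto simp: S Cons boundary_Cons_vimage_cylinder mem_cylinder_Cons)
        then show ?thesis
          by (simp only: measure_empty)
      next
        case 2
        then show ?thesis
          by (simp add: S Cons boundary_Cons_vimage_cylinder compl letter)
      next
        case 3
        have "cylinder v - cylinder [inv_letter x] = {}"
        proof (cases "reduced v")
          case True
          then have "hd v = inv_letter x"
            using 3 by (simp add: Cons reduced_Cons)
          then show ?thesis
            using 3(2) by (cases v) (auto simp: mem_cylinder_Cons)
        qed (simp add: cylinder_not_reduced)
        then have "boundary_Cons x -` S \<inter> free_boundary - cylinder [inv_letter x] = {}"
          using 3 by (simp add: S Cons boundary_Cons_vimage_cylinder)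
        moreover have "S = {}" using 3 by (simp add: S cylinder_not_reduced)
        ultimately show ?thesis by simp
      next
        case 4
        have v: "reduced v" "hd v \<noteq> inv_letter x"
          using 4 by (auto simp: Cons reduced_Cons)
        have "cylinder v - cylinder [inv_letter x] = cylinder v"
          using v 4(2) by (cases v) (auto simp: mem_cylinder_Cons)
        moreover have "S \<inter> cylinder [x] = cylinder w"
          using 4 by (auto simp: S Cons mem_cylinder_Cons)
        ultimately have "measure M (boundary_Cons x -` S \<inter> free_boundary - cylinder [inv_letter x])
            = measure M (cylinder v)" "S \<inter> cylinder [x] = cylinder w"
          using 4 by (simp_all add: S Cons boundary_Cons_vimage_cylinder)
        moreover have "measure M (cylinder v) = q * measure M (cylinder w)"
          using 4 v q_pos by (cases v) (auto simp: measure_cylinder Cons)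
        ultimately show ?thesis by simp
      qed
    qed
    then show "emeasure Q S = emeasure P S"
      by (simp add: P Q S)
  next
    show "range (\<lambda>_::nat. free_boundary) \<subseteq> range (cylinder :: 'a letter list \<Rightarrow> _)"
      by (auto intro: range_eqI[of _ _ "[]"])
    show "emeasure Q free_boundary \<noteq> \<infinity>"
      using boundary by (simp add: Q)
  qed (use cylinder_subset in \<open>auto simp: P_def Q_def sets_M\<close>)
  then have "ennreal (measure M (boundary_Cons x -` E \<inter> free_boundary - cylinder [inv_letter x]))
      = ennreal (q * measure M (E \<inter> cylinder [x]))"
    using P[OF assms] Q[OF assms] by simp
  then show ?thesis
    using q_pos by (subst (asm) ennreal_inj) auto
qed

text \<open>Cancelling against \<open>x\<close> undoes the prepending of
  \<open>inv_letter x\<close>, so this is the previous scaling for the inverse letter; by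
  reducedness the image avoids \<open>cylinder [x]\<close>.\<close>

lemma measure_boundary_Cons_image_cancel:
  assumes "E \<in> sets M" "E \<subseteq> cylinder [inv_letter x]"
  shows "measure M (boundary_Cons x ` E) = q * measure M E"
proof -
  have "boundary_Cons x ` E \<inter> cylinder [x] = {}"
  proof -
    have "boundary_Cons x \<omega> 0 \<noteq> x" if "\<omega> \<in> E" for \<omega>
      using that assms(2)
      by (auto simp: mem_cylinder_Cons boundary_Cons_def free_boundary_def dest!: subsetD spec[of _ 0])
    then show ?thesis by (auto simp: mem_cylinder_Cons)
  qed
  then have "boundary_Cons (inv_letter x) -` E \<inter> free_boundary - cylinder [x] = boundary_Cons x ` E"
    using assms by (auto simp: boundary_Cons_image sets_subset)
  then show ?thesis
    using measure_boundary_Cons_vimage[OF assms(1), of "inv_letter x"] assms(2)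
    by (simp add: Int_absorb2)
qed

text \<open>The same scaling applied to the image of \<open>E\<close>, which lies in
  \<open>cylinder [x]\<close> and whose preimage is \<open>E\<close> by injectivity.\<close>

lemma measure_boundary_Cons_image_add:
  assumes "E \<in> sets M" "E \<inter> cylinder [inv_letter x] = {}"
  shows "q * measure M (boundary_Cons x ` E) = measure M E"
proof -
  have E: "E \<subseteq> free_boundary" using assms(1) by (rule sets_subset)
  have "boundary_Cons x ` E \<subseteq> cylinder [x]"
  proof
    fix \<eta> assume "\<eta> \<in> boundary_Cons x ` E"
    then obtain \<omega> where "\<omega> \<in> E" "\<eta> = boundary_Cons x \<omega>" by auto
    moreover from this have "\<omega> \<notin> cylinder [inv_letter x]"
      using assms(2) by auto
    then have "\<omega> 0 \<noteq> inv_letter x"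
      using \<open>\<omega> \<in> E\<close> E by (auto simp: mem_cylinder_Cons)
    ultimately show "\<eta> \<in> cylinder [x]"
      using E boundary_Cons_in_boundary[of \<omega> x]
      by (auto simp: mem_cylinder_Cons boundary_Cons_def)
  qed
  moreover have "boundary_Cons x -` (boundary_Cons x ` E) \<inter> free_boundary = E"
    using E inj_on_boundary_act[of "[x]"] by (auto simp: inj_on_def)
  moreover have "E - cylinder [inv_letter x] = E" using assms(2) by auto
  ultimately show ?thesis
    using measure_boundary_Cons_vimage[OF boundary_Cons_image_sets[OF assms(1)], of x x]
    by (simp add: Int_absorb2)
qed

text \<open>A one-sided change of variables: the density is
  \<open>q powi busemann g \<omega>\<close>, and a constant lower bound on the exponent avoids
  integration.\<close>

lemma measure_boundary_act_image_ge:
  assumes "E \<in> sets M" "\<And>\<omega>. \<omega> \<in> E \<Longrightarrow> k \<le> busemann g \<omega>"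
  shows "q powi k * measure M E \<le> measure M (boundary_act g ` E)"
  using assms
proof (induction g arbitrary: E k)
  case Nil
  show ?case
  proof (cases "E = {}")
    case False
    \<comment> \<open>Any point of \<open>E\<close> shows this, as \<open>busemann []\<close>
      vanishes.\<close>
    then have "k \<le> 0" using Nil by auto
    then have "q powi k \<le> 1" using q_ge power_int_increasing[of k 0 q] by simp
    then show ?thesis using mult_right_mono[of "q powi k" 1 "measure M E"] by simp
  qed simp
next
  case (Cons x g)
  \<comment> \<open>\<open>V\<close> is the set where the outermost letter \<open>x\<close> cancels.
    There it contributes a factor \<open>q\<close>, and the induction hypothesis is used with
    \<open>k - 1\<close>; elsewhere it contributes \<open>1 / q\<close>, and the hypothesis is used
    with \<open>k + 1\<close>.\<close>
  define V where "V = boundary_act g -` cylinder [inv_letter x] \<inter> space M"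
  have V: "V \<in> sets M" unfolding V_def by measurable
  have Vx: "boundary_act g \<omega> 0 = inv_letter x \<longleftrightarrow> \<omega> \<in> V" if "\<omega> \<in> E" for \<omega>
    using that sets_subset[OF Cons.prems(1)] boundary_act_in_boundary[of \<omega> g]
    by (auto simp: V_def space_M mem_cylinder_Cons)
  let ?E1 = "E \<inter> V" and ?E2 = "E - V"
  have sets: "?E1 \<in> sets M" "?E2 \<in> sets M" using Cons.prems(1) V by auto
  have "q powi k * measure M ?E1 = q * (q powi (k - 1) * measure M ?E1)"
    using q_pos power_int_add_1[of q "k - 1"] by simp
  also have "\<dots> \<le> q * measure M (boundary_act g ` ?E1)"
    using Cons.prems(2) Vx q_pos
    by (intro mult_left_mono Cons.IH sets) (force split: if_splits)+
  also have "\<dots> = measure M (boundary_Cons x ` boundary_act g ` ?E1)"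
    by (rule measure_boundary_Cons_image_cancel[symmetric, OF boundary_act_image_sets[OF sets(1)]])
      (auto simp: V_def)
  finally have 1: "q powi k * measure M ?E1 \<le> measure M (boundary_act (x # g) ` ?E1)"
    by (simp add: image_image)
  have "q * (q powi k * measure M ?E2) = q powi (k + 1) * measure M ?E2"
    using q_pos by (simp add: power_int_add_1)
  also have "\<dots> \<le> measure M (boundary_act g ` ?E2)"
    using Cons.prems(2) Vx by (intro Cons.IH sets) (force split: if_splits)
  also have "\<dots> = q * measure M (boundary_Cons x ` boundary_act g ` ?E2)"
    using Vx by (intro measure_boundary_Cons_image_add[symmetric] boundary_act_image_sets sets)
      (auto simp: mem_cylinder_Cons)
  finally have 2: "q powi k * measure M ?E2 \<le> measure M (boundary_act (x # g) ` ?E2)"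
    using q_pos by (simp add: image_image)
  have inj: "inj_on (boundary_act (x # g)) E"
    using inj_on_boundary_act sets_subset[OF Cons.prems(1)] by (rule inj_on_subset)
  have "measure M (boundary_act (x # g) ` E)
      = measure M (boundary_act (x # g) ` ?E1 \<union> boundary_act (x # g) ` ?E2)"
    by (simp add: Int_Diff_Un flip: image_Un)
  also have "\<dots> = measure M (boundary_act (x # g) ` ?E1) + measure M (boundary_act (x # g) ` ?E2)"
    using inj by (intro finite_measure_Union boundary_act_image_sets sets) (auto simp: inj_on_def)
  finally have image: "measure M (boundary_act (x # g) ` E)
      = measure M (boundary_act (x # g) ` ?E1) + measure M (boundary_act (x # g) ` ?E2)" .
  have "measure M E = measure M ?E1 + measure M ?E2"
    using finite_measure_Union[OF sets] by (simp add: Int_Diff_Un Int_Diff_disjoint)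
  then show ?case using 1 2 image by (simp add: distrib_left)
qed

text \<open>The lower bound for the inverse of \<open>g\<close>, with the crude exponent from
  \<open>busemann_ge\<close>, bounds the measure of the image by a constant multiple of that of
  \<open>E\<close>.\<close>

lemma null_boundary_act_image:
  assumes E: "E \<in> sets M" and "measure M E = 0" and g: "reduced g"
  shows "measure M (boundary_act g ` E) = 0"
proof -
  define g' where "g' = inv\<^bsub>free_group\<^esub> g"
  have "boundary_act g' ` boundary_act g ` E = E"
    using sets_subset[OF E] g by (force simp: g'_def image_image boundary_act_inv)
  then have "q powi (- int (length g')) * measure M (boundary_act g ` E) \<le> 0"
    using measure_boundary_act_image_ge[OF boundary_act_image_sets[OF E],
        of g "- int (length g')" g', OF busemann_ge]
    by (simp add: assms(2))
  moreover have "q powi (- int (length g')) > 0"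
    using q_pos by (rule zero_less_power_int)
  ultimately have "measure M (boundary_act g ` E) \<le> 0"
    by (simp add: mult_le_0_iff)
  then show ?thesis
    by (intro antisym measure_nonneg)
qed

lemma measurable_busemann [measurable]: "busemann g \<in> measurable M (count_space UNIV)"
proof (induction g)
  case (Cons x g)
  have "busemann (x # g) \<omega> =
      busemann g \<omega> + (if boundary_act g \<omega> \<in> cylinder [inv_letter x] then 1 else - 1)"
    if "\<omega> \<in> space M" for \<omega>
    using that boundary_act_in_boundary[of \<omega> g] by (auto simp: space_M mem_cylinder_Cons)
  then show ?case
    using Cons by (subst measurable_cong) (assumption, measurable)
qed simp

section \<open>Counting words by the measure of cylinders\<close>

lemma measure_initial_word_in:
  assumes "\<And>w. w \<in> S \<Longrightarrow> reduced w \<and> length w = n" and "n > 0"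
  shows "measure M {\<omega> \<in> free_boundary. initial_word n \<omega> \<in> S} = real (card S) / ((q + 1) * q ^ (n - 1))"
    and "{\<omega> \<in> free_boundary. initial_word n \<omega> \<in> S} \<in> sets M"
proof -
  have fin: "finite S"
    by (rule finite_subset[OF _ finite_lists_length_eq[of UNIV n]]) (use assms in auto)
  have eq: "{\<omega> \<in> free_boundary. initial_word n \<omega> \<in> S} = (\<Union>w\<in>S. cylinder w)"
    using assms by (auto simp: mem_cylinder_iff)
  show "{\<omega> \<in> free_boundary. initial_word n \<omega> \<in> S} \<in> sets M"
    unfolding eq using fin by auto
  have "measure M (\<Union>w\<in>S. cylinder w) = (\<Sum>w\<in>S. measure M (cylinder w))"
    using fin assms
    by (intro finite_measure_finite_Union) (auto simp: disjoint_family_on_def mem_cylinder_iff)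
  also have "\<dots> = (\<Sum>w\<in>S. 1 / ((q + 1) * q ^ (n - 1)))"
    using assms by (intro sum.cong refl) (subst measure_cylinder, auto)
  finally show "measure M {\<omega> \<in> free_boundary. initial_word n \<omega> \<in> S}
      = real (card S) / ((q + 1) * q ^ (n - 1))"
    by (simp add: eq)
qed

text \<open>The count follows from total mass 1, since the cylinders of all reduced words of length
  \<open>n\<close> have equal measure.\<close>

lemma card_free_sphere:
  assumes "n > 0"
  shows "real (card (free_sphere n :: 'a letter list set)) = (q + 1) * q ^ (n - 1)"
proof -
  have "{\<omega> \<in> free_boundary. initial_word n \<omega> \<in> free_sphere n} = space M"
    by (auto simp: free_sphere_eq space_M reduced_initial_word)
  moreover have "measure M {\<omega> \<in> free_boundary. initial_word n \<omega> \<in> free_sphere n}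
      = real (card (free_sphere n :: 'a letter list set)) / ((q + 1) * q ^ (n - 1))"
    using assms by (intro measure_initial_word_in(1)) (auto simp: free_sphere_eq)
  ultimately have "real (card (free_sphere n :: 'a letter list set)) / ((q + 1) * q ^ (n - 1)) = 1"
    using prob_space by (simp only:)
  then show ?thesis
    by (simp only: divide_eq_1_iff)
qed

end

section \<open>The Schreier limit set\<close>

text \<open>The set \<open>\<Omega>\<close> of ends of the spanning tree.\<close>

definition schreier_limit_set :: "'a::finite letter list set \<Rightarrow> (nat \<Rightarrow> 'a letter) set" where
  "schreier_limit_set H =
     {\<omega> \<in> free_boundary. \<forall>n. initial_word n \<omega> \<in> schreier_transversal H}"

lemma schreier_limit_set_boundary: "\<omega> \<in> schreier_limit_set H \<Longrightarrow> \<omega> \<in> free_boundary"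
  by (simp add: schreier_limit_set_def)

lemma initial_word_schreier_transversal_mono:
  assumes H: "subgroup H free_group" and n: "initial_word n \<omega> \<in> schreier_transversal H" and "m \<le> n"
  shows "initial_word m \<omega> \<in> schreier_transversal H"
proof -
  have "initial_word n \<omega> = initial_word m \<omega> @ map \<omega> [m..<n]"
    using upt_add_eq_append[of 0 m "n - m"] \<open>m \<le> n\<close> by simp
  then show ?thesis
    using schreier_transversal_prefix[OF H, of "initial_word m \<omega>"] n by simp
qed

text \<open>Cut \<open>\<omega>\<close> after \<open>length h\<close> letters:
  \<open>boundary_act h \<omega>\<close> then begins with the reduced product of \<open>h\<close>
  and this initial word. Both words are minimal in one coset, hence equal, which forces
  \<open>h\<close> to be trivial.\<close>

lemma schreier_limit_set_wandering:
  assumes H: "subgroup H free_group" and h: "h \<in> H"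
    and \<omega>: "\<omega> \<in> schreier_limit_set H" and h\<omega>: "boundary_act h \<omega> \<in> schreier_limit_set H"
  shows "h = []"
proof -
  define n where "n = length h"
  define u where "u = initial_word n \<omega>"
  define w where "w = h \<otimes>\<^bsub>free_group\<^esub> u"
  have bd: "\<omega> \<in> free_boundary" using \<omega> by (rule schreier_limit_set_boundary)
  have red: "reduced h" "reduced u"
    using reduced_subgroup[OF H h] reduced_initial_word[OF bd] by (simp_all add: u_def)
  have "initial_word (length w) (boundary_act h \<omega>) = w"
    using boundary_act_initial_word(1)[OF bd, of h n]
    by (simp add: n_def u_def w_def mult_free_group initial_word_append_seq)
  then have "w \<in> schreier_transversal H"
    using h\<omega> by (simp add: schreier_limit_set_def) metis
  moreover have "u \<in> schreier_transversal H"
    using \<omega> by (simp add: schreier_limit_set_def u_def)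
  moreover have "w \<in> H #>\<^bsub>free_group\<^esub> u"
    using h by (auto simp: r_coset_def w_def)
  ultimately have "w = u"
    using schreier_transversal_unique[OF H] by blast
  then have "h \<otimes>\<^bsub>free_group\<^esub> u = \<one>\<^bsub>free_group\<^esub> \<otimes>\<^bsub>free_group\<^esub> u"
    using red by (simp add: w_def mult_free_group reduce_reduced)
  then show ?thesis
    using red free_group.right_cancel[of u h "\<one>\<^bsub>free_group\<^esub>"] by simp
qed

text \<open>
  Replacing the initial word of \<open>\<omega>\<close> of length \<open>n\<close> by the minimal representative of its coset is
  the action of an element of \<open>H\<close> which does not lower the density. If only finitely many such
  elements occurred, one of them would occur infinitely often, and it would move \<open>\<omega>\<close> into the
  limit set.
\<close>

lemma infinite_busemann_nonneg:
  assumes H: "subgroup H free_group" and \<omega>: "\<omega> \<in> free_boundary"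
    and outside: "\<And>h. h \<in> H \<Longrightarrow> boundary_act h \<omega> \<notin> schreier_limit_set H"
  shows "infinite {h \<in> H. 0 \<le> busemann h \<omega>}"
proof
  assume fin: "finite {h \<in> H. 0 \<le> busemann h \<omega>}"
  have red: "reduced (initial_word n \<omega>)" for n
    by (rule reduced_initial_word[OF \<omega>])
  have "\<exists>t. t \<in> schreier_transversal H \<and> t \<in> H #>\<^bsub>free_group\<^esub> initial_word n \<omega> \<and> length t \<le> n" for n
    using schreier_transversal_exists[OF H red, of n] by (metis length_map length_upt minus_nat.diff_0)
  then obtain t where t: "\<And>n. t n \<in> schreier_transversal H"
    "\<And>n. t n \<in> H #>\<^bsub>free_group\<^esub> initial_word n \<omega>" "\<And>n. length (t n) \<le> n"
    by metis
  have "\<exists>h\<in>H. t n = h \<otimes>\<^bsub>free_group\<^esub> initial_word n \<omega>" for n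
    using t(2)[of n] by (auto simp: r_coset_def)
  then obtain h where h: "\<And>n. h n \<in> H" "\<And>n. t n = reduce (h n @ initial_word n \<omega>)"
    unfolding mult_free_group by metis
  have nonneg: "0 \<le> busemann (h n) \<omega>" for n
  proof -
    \<comment> \<open>The length formula requires an initial word at least as long as
      \<open>h n\<close>. The added letters lengthen the product by at most \<open>N - n\<close>, so
      its length stays at most \<open>N\<close>.\<close>
    define N where "N = n + length (h n)"
    have "initial_word N \<omega> = initial_word n \<omega> @ map \<omega> [n..<N]"
      using upt_add_eq_append[of 0 n "length (h n)"] by (simp add: N_def)
    then have "reduce (h n @ initial_word N \<omega>) = reduce (t n @ map \<omega> [n..<N])"
      by (simp add: h(2))
    also have "length \<dots> \<le> length (t n @ map \<omega> [n..<N])"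
      by (rule length_reduce_le)
    also have "\<dots> \<le> N"
      using t(3)[of n] by (simp add: N_def)
    finally show ?thesis
      using boundary_act_initial_word(2)[OF \<omega>, of "h n" N] by (simp add: N_def)
  qed
  then have "range h \<subseteq> {h \<in> H. 0 \<le> busemann h \<omega>}" using h(1) by auto
  then have "finite (range h)" using fin by (rule finite_subset)
  then obtain k where "infinite {n. h n = k}"
    using pigeonhole_infinite[of "UNIV :: nat set" h] by auto
  then have often: "\<exists>n\<ge>m. h n = k" for m
    unfolding infinite_nat_iff_unbounded_le by auto
  then have "k \<in> H" using h(1) by blast
  have "initial_word m (boundary_act k \<omega>) \<in> schreier_transversal H" for m
  proof -
    \<comment> \<open>For such \<open>n\<close> the tree word \<open>t n\<close> is a prefix of
      \<open>boundary_act k \<omega>\<close>; at most \<open>length k\<close> letters were lost, so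
      its length is at least \<open>m\<close>.\<close>
    obtain n where n: "n \<ge> m + length k" "h n = k" using often by blast
    have "boundary_act k \<omega> = append_seq (t n) (\<lambda>i. \<omega> (n + i))" "n \<le> length k + length (t n)"
      using boundary_act_initial_word[OF \<omega>, of k n] n h(2)[of n] by auto
    then have "initial_word (length (t n)) (boundary_act k \<omega>) \<in> schreier_transversal H" "m \<le> length (t n)"
      using t(1)[of n] n(1) by (simp_all add: initial_word_append_seq)
    then show ?thesis by (rule initial_word_schreier_transversal_mono[OF H])
  qed
  then have "boundary_act k \<omega> \<in> schreier_limit_set H"
    using boundary_act_in_boundary[OF \<omega>] by (simp add: schreier_limit_set_def)
  then show False using outside[OF \<open>k \<in> H\<close>] by simp
qed

section \<open>Measure of the limit set and conservativity\<close>

context uniform_boundary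
begin

context
  fixes H :: "'a letter list set"
  assumes H: "subgroup H free_group"
begin

text \<open>The limit set is the decreasing intersection of the sets \<open>D n\<close> given by
  initial words, so continuity from above yields the limit.\<close>

lemma schreier_sphere_ratio_tendsto:
  shows "(\<lambda>n. real (card (schreier_sphere H n)) / ((q + 1) * q ^ (n - 1)))
      \<longlonglongrightarrow> measure M (schreier_limit_set H)"
    and schreier_limit_set_sets: "schreier_limit_set H \<in> sets M"
proof -
  define D where "D n = {\<omega> \<in> free_boundary. initial_word n \<omega> \<in> schreier_transversal H}" for n
  let ?T = "\<lambda>n. {w \<in> schreier_transversal H. length w = n}"
  have D_eq: "D n = {\<omega> \<in> free_boundary. initial_word n \<omega> \<in> ?T n}" for n
    by (auto simp: D_def)
  have D: "D n \<in> sets M"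
    "measure M (D n) = real (card (schreier_sphere H n)) / ((q + 1) * q ^ (n - 1))" if "n > 0" for n
    using measure_initial_word_in[of "?T n" n] that
    by (auto simp: D_eq card_schreier_sphere[OF H] schreier_transversal_def)
  have "decseq D"
    using initial_word_schreier_transversal_mono[OF H]
    by (intro decseq_SucI) (auto simp: D_def simp del: upt_Suc)
  \<comment> \<open>The index starts at 1, because the measure of \<open>D n\<close> comes from the
    cylinder formula, which requires positive length.\<close>
  then have dec: "decseq (\<lambda>n. D (Suc n))"
    by (auto simp: decseq_def)
  have "(\<Inter>n. D (Suc n)) \<subseteq> D n" for n
    using decseq_SucD[OF \<open>decseq D\<close>, of n] by blast
  then have "(\<Inter>n. D (Suc n)) = (\<Inter>n. D n)"
    by (intro equalityI INT_greatest) auto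
  also have "\<dots> = schreier_limit_set H"
    by (auto simp: D_def schreier_limit_set_def)
  finally have Inter: "(\<Inter>n. D (Suc n)) = schreier_limit_set H" .
  have "(\<lambda>n. measure M (D (Suc n))) \<longlonglongrightarrow> measure M (schreier_limit_set H)"
    unfolding Inter[symmetric] using D(1) dec by (intro finite_Lim_measure_decseq) auto
  then have "(\<lambda>n. measure M (D n)) \<longlonglongrightarrow> measure M (schreier_limit_set H)"
    by (rule LIMSEQ_imp_Suc)
  moreover have "eventually (\<lambda>n. measure M (D n)
      = real (card (schreier_sphere H n)) / ((q + 1) * q ^ (n - 1))) sequentially"
    using eventually_gt_at_top[of 0] by eventually_elim (rule D(2))
  ultimately show "(\<lambda>n. real (card (schreier_sphere H n)) / ((q + 1) * q ^ (n - 1)))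
      \<longlonglongrightarrow> measure M (schreier_limit_set H)"
    by (rule Lim_transform_eventually)
  show "schreier_limit_set H \<in> sets M"
    unfolding Inter[symmetric] using D(1) by (intro sets.countable_INT) auto
qed

lemma conservative_action_iff_recurrent:
  "conservative_action (free_group\<lparr>carrier := H\<rparr>) boundary_act M \<longleftrightarrow>
     (\<forall>A\<in>sets M. measure M A > 0 \<longrightarrow>
        (AE \<omega> in M. \<omega> \<in> A \<longrightarrow> \<omega> \<in> (\<Union>h\<in>H - {[]}. boundary_act h ` A)))"
proof -
  have "\<one>\<^bsub>free_group\<lparr>carrier := H\<rparr>\<^esub> = []" by (simp add: free_group_def)
  then show ?thesis
    by (simp add: conservative_action_def emeasure_eq_measure)
qed

text \<open>No point of the limit set lies in a nontrivial translate of it, so recurrence of this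
  set would contradict positive measure.\<close>

lemma conservative_imp_null_limit_set:
  assumes "conservative_action (free_group\<lparr>carrier := H\<rparr>) boundary_act M"
  shows "measure M (schreier_limit_set H) = 0"
proof (rule ccontr)
  assume "measure M (schreier_limit_set H) \<noteq> 0"
  then have "measure M (schreier_limit_set H) > 0"
    by (simp add: less_le)
  then have "AE \<omega> in M. \<omega> \<in> schreier_limit_set H \<longrightarrow>
      \<omega> \<in> (\<Union>h\<in>H - {[]}. boundary_act h ` schreier_limit_set H)"
    using assms schreier_limit_set_sets unfolding conservative_action_iff_recurrent by blast
  then have "AE \<omega> in M. \<omega> \<notin> schreier_limit_set H"
    by eventually_elim (use schreier_limit_set_wandering[OF H] in blast)
  then have "measure M (schreier_limit_set H) = 0"
    using schreier_limit_set_sets AE_iff_null_sets measure_eq_0_null_sets by blast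
  with \<open>measure M (schreier_limit_set H) \<noteq> 0\<close> show False ..
qed

text \<open>A point that some \<open>h\<close> moves into the limit set lies in its translate by the
  inverse of \<open>h\<close>. These are countably many null sets, and
  \<open>infinite_busemann_nonneg\<close> applies off their union.\<close>

lemma null_limit_set_imp_AE_infinite:
  assumes "measure M (schreier_limit_set H) = 0"
  shows "AE \<omega> in M. infinite {h \<in> H. 0 \<le> busemann h \<omega>}"
proof -
  have "AE \<omega> in M. \<forall>h\<in>H. \<omega> \<notin> boundary_act (inv\<^bsub>free_group\<^esub> h) ` schreier_limit_set H"
  proof (subst AE_ball_countable)
    show "\<forall>h\<in>H. AE \<omega> in M. \<omega> \<notin> boundary_act (inv\<^bsub>free_group\<^esub> h) ` schreier_limit_set H"
    proof
      fix h assume "h \<in> H"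
      then have "reduced (inv\<^bsub>free_group\<^esub> h)"
        using reduced_subgroup[OF H] free_group.inv_closed[of h] by simp
      then have "measure M (boundary_act (inv\<^bsub>free_group\<^esub> h) ` schreier_limit_set H) = 0"
        using assms schreier_limit_set_sets by (intro null_boundary_act_image)
      then have "boundary_act (inv\<^bsub>free_group\<^esub> h) ` schreier_limit_set H \<in> null_sets M"
        using boundary_act_image_sets[OF schreier_limit_set_sets]
        by (auto simp: null_sets_def emeasure_eq_measure)
      then show "AE \<omega> in M. \<omega> \<notin> boundary_act (inv\<^bsub>free_group\<^esub> h) ` schreier_limit_set H"
        by (rule AE_not_in)
    qed
  qed (rule countableI_type)
  with AE_space show ?thesis
  proof eventually_elim
    case (elim \<omega>)
    then have "boundary_act h \<omega> \<notin> schreier_limit_set H" if "h \<in> H" for h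
      using that boundary_act_inv(1)[of \<omega> h] reduced_subgroup[OF H that]
      by (force simp: space_M intro: image_eqI)
    then show ?case
      using elim by (intro infinite_busemann_nonneg[OF H]) (auto simp: space_M)
  qed
qed

text \<open>Borel-Cantelli: the part of \<open>B\<close> where the derivative of \<open>h\<close> is
  at least 1 has at most the measure of its image under \<open>h\<close>. These images are disjoint
  in a probability space, so the measures are summable.\<close>

lemma wandering_AE_finite:
  assumes B: "B \<in> sets M"
    and disj: "\<And>g h. g \<in> H \<Longrightarrow> h \<in> H \<Longrightarrow> g \<noteq> h \<Longrightarrow> boundary_act g ` B \<inter> boundary_act h ` B = {}"
  shows "AE \<omega> in M. \<omega> \<in> B \<longrightarrow> finite {h \<in> H. 0 \<le> busemann h \<omega>}"
proof -
  define C where "C h = B \<inter> {\<omega> \<in> space M. 0 \<le> busemann h \<omega>}" for h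
  have C: "C h \<in> sets M" for h
    using B unfolding C_def by measurable
  \<comment> \<open>Elements of \<open>H\<close> are indexed by their codes to form a sequence;
    indices that code no element of \<open>H\<close> get the empty set.\<close>
  define A where "A n = (if \<exists>h\<in>H. to_nat h = n then C (from_nat n) else {})" for n
  define D where "D n = boundary_act (from_nat n) ` A n" for n
  have A: "A n \<in> sets M" for n
    using C by (simp add: A_def)
  have D: "D n \<in> sets M" for n
    unfolding D_def by (rule boundary_act_image_sets[OF A])
  have "disjoint_family D"
    unfolding disjoint_family_on_def
  proof (intro ballI impI)
    fix m n :: nat assume "m \<noteq> n"
    show "D m \<inter> D n = {}"
    proof (cases "\<exists>g\<in>H. \<exists>h\<in>H. to_nat g = m \<and> to_nat h = n")
      case True
      then obtain g h where gh: "g \<in> H" "h \<in> H" "m = to_nat g" "n = to_nat h" by auto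
      then have "D m \<subseteq> boundary_act g ` B" "D n \<subseteq> boundary_act h ` B"
        by (auto simp: D_def A_def C_def)
      then show ?thesis
        using disj[OF gh(1,2)] gh \<open>m \<noteq> n\<close> by auto
    qed (auto simp: D_def A_def)
  qed
  then have summable: "summable (\<lambda>n. measure M (D n))"
    using D finite_measure_UNION[of D] by (auto simp: sums_iff)
  have "measure M (A n) \<le> measure M (D n)" for n
    \<comment> \<open>The exponent 0 turns the factor into 1; it is admissible because the cocycle
      is nonnegative on \<open>A n\<close>.\<close>
    using measure_boundary_act_image_ge[OF A, of n 0 "from_nat n"]
    by (auto simp: D_def A_def C_def split: if_splits)
  then have "summable (\<lambda>n. measure M (A n))"
    using summable_comparison_test'[OF summable, of 0 "\<lambda>n. measure M (A n)"] by simp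
  then have "AE \<omega> in M. eventually (\<lambda>n. \<omega> \<in> space M - A n) sequentially"
    using A by (intro borel_cantelli_AE1) (auto simp: emeasure_eq_measure)
  then show ?thesis
  proof eventually_elim
    case (elim \<omega>)
    then obtain N where N: "\<And>n. n \<ge> N \<Longrightarrow> \<omega> \<notin> A n" "\<omega> \<in> space M"
      by (auto simp: eventually_sequentially)
    show ?case
    proof
      assume "\<omega> \<in> B"
      have "to_nat h < N" if "h \<in> H" "0 \<le> busemann h \<omega>" for h
      proof (rule ccontr)
        assume "\<not> to_nat h < N"
        then have "\<omega> \<notin> A (to_nat h)" by (intro N) simp
        then show False
          using that \<open>\<omega> \<in> B\<close> N(2) by (auto simp: A_def C_def)
      qed
      then have "{h \<in> H. 0 \<le> busemann h \<omega>} \<subseteq> from_nat ` {..<N}"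
        by (auto intro!: image_eqI[of _ _ "to_nat _"])
      then show "finite {h \<in> H. 0 \<le> busemann h \<omega>}"
        by (rule finite_subset) simp
    qed
  qed
qed

text \<open>The non-recurrent part \<open>B\<close> of \<open>A\<close> has disjoint translates.
  Almost every point of it would thus have only finitely many elements with nonnegative cocycle,
  against the infinitely many forced by a null limit set.\<close>

lemma null_limit_set_imp_conservative:
  assumes "measure M (schreier_limit_set H) = 0"
  shows "conservative_action (free_group\<lparr>carrier := H\<rparr>) boundary_act M"
  unfolding conservative_action_iff_recurrent
proof (intro ballI impI)
  fix A assume A: "A \<in> sets M"
  define B where "B = A - (\<Union>h\<in>H - {[]}. boundary_act h ` A)"
  have "(\<Union>h\<in>H - {[]}. boundary_act h ` A) \<in> sets M"
    by (rule sets.countable_UN') (use A boundary_act_image_sets in auto)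
  then have B: "B \<in> sets M" using A by (simp add: B_def)
  have "boundary_act g ` B \<inter> boundary_act h ` B = {}" if gh: "g \<in> H" "h \<in> H" "g \<noteq> h" for g h
  proof (rule ccontr)
    assume "boundary_act g ` B \<inter> boundary_act h ` B \<noteq> {}"
    then obtain \<omega> \<eta> where \<omega>\<eta>: "\<omega> \<in> B" "\<eta> \<in> B" "boundary_act g \<omega> = boundary_act h \<eta>" by auto
    have red: "reduced g" "reduced h"
      using gh reduced_subgroup[OF H] by auto
    have bd: "\<omega> \<in> free_boundary" "\<eta> \<in> free_boundary"
      using \<omega>\<eta> sets_subset[OF B] by auto
    \<comment> \<open>This \<open>k\<close> maps \<open>\<omega>\<close> to \<open>\<eta>\<close>,
      so \<open>\<eta>\<close> would lie in a nontrivial translate of \<open>A\<close>, which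
      \<open>B\<close> excludes.\<close>
    define k where "k = inv\<^bsub>free_group\<^esub> h \<otimes>\<^bsub>free_group\<^esub> g"
    have "boundary_act k \<omega> = \<eta>"
      using red bd by (simp add: k_def boundary_act_mult \<omega>\<eta>(3) boundary_act_inv)
    moreover have "k \<in> H"
      using gh H by (simp add: k_def subgroup.m_closed subgroup.m_inv_closed)
    moreover have "k \<noteq> []"
    proof
      assume "k = []"
      then have "g = h \<otimes>\<^bsub>free_group\<^esub> []"
        using red free_group.inv_solve_left[of "[]" h g] by (simp add: k_def)
      then show False using gh(3) red by (simp add: mult_free_group reduce_reduced)
    qed
    ultimately show False
      using \<omega>\<eta>(1,2) by (auto simp: B_def)
  qed
  then have "AE \<omega> in M. \<omega> \<in> B \<longrightarrow> finite {h \<in> H. 0 \<le> busemann h \<omega>}"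
    by (intro wandering_AE_finite B)
  with null_limit_set_imp_AE_infinite[OF assms]
  show "AE \<omega> in M. \<omega> \<in> A \<longrightarrow> \<omega> \<in> (\<Union>h\<in>H - {[]}. boundary_act h ` A)"
    by eventually_elim (auto simp: B_def)
qed

end

end

theorem theorem4p12:
  fixes H :: "'a::finite letter list set"
    and M :: "(nat \<Rightarrow> 'a letter) measure"
  assumes "CARD('a) \<ge> 2"
    and "is_uniform_boundary_measure M"
    and "subgroup H free_group"
    and "H \<noteq> {\<one>\<^bsub>free_group\<^esub>}"
  shows "conservative_action (free_group\<lparr>carrier := H\<rparr>) boundary_act M \<longleftrightarrow>
    (\<lambda>n. real (card (schreier_sphere H n)) / real (card (free_sphere n :: 'a letter list set)))
      \<longlonglongrightarrow> 0 \<and>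
    (\<lambda>n. real (card (schreier_sphere H n)) /
        (2 * real CARD('a) * (2 * real CARD('a) - 1) ^ (n - 1))) \<longlonglongrightarrow> 0"
proof -
  interpret uniform_boundary M
    using assms by unfold_locales
  let ?r = "\<lambda>n. real (card (schreier_sphere H n)) / ((q + 1) * q ^ (n - 1))"
  let ?s = "\<lambda>n. real (card (schreier_sphere H n)) / real (card (free_sphere n :: 'a letter list set))"
  have r: "?r \<longlonglongrightarrow> measure M (schreier_limit_set H)"
    by (rule schreier_sphere_ratio_tendsto[OF assms(3)])
  \<comment> \<open>At \<open>n = 0\<close> natural subtraction makes the denominator of
    \<open>?r\<close> equal to \<open>q + 1\<close>, while the sphere is a single point; eventual
    equality is enough.\<close>
  have "eventually (\<lambda>n. ?s n = ?r n) sequentially"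
    using eventually_gt_at_top[of 0] by eventually_elim (simp add: card_free_sphere)
  then have "?s \<longlonglongrightarrow> 0 \<longleftrightarrow> ?r \<longlonglongrightarrow> 0"
    by (rule tendsto_cong)
  \<comment> \<open>\<open>?r\<close> always converges, so tending to 0 means that its limit, the
    measure of the limit set, is 0.\<close>
  moreover have "?r \<longlonglongrightarrow> 0 \<longleftrightarrow> measure M (schreier_limit_set H) = 0"
    using r LIMSEQ_unique[OF r, of 0] by auto
  moreover have "conservative_action (free_group\<lparr>carrier := H\<rparr>) boundary_act M \<longleftrightarrow>
      measure M (schreier_limit_set H) = 0"
    using conservative_imp_null_limit_set[OF assms(3)] null_limit_set_imp_conservative[OF assms(3)]
    by blast
  ultimately show ?thesis
    by (simp add: q_def)
qed

end
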